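(* For all $L\in\mathbf N$, all integers $\nu\ge 1$, and all $s\in\{0,1,\ldots,\nu-1\}$, $$G\left(L,\;L+1+2s,\;(\nu+1)\left(1+\frac{1+2s}{2\nu+1}\right),\;(\nu+1)\left(1-\frac{1+2s}{2\nu+1}\right),\;2\nu+1,\;q\right)\geq 0.$$
   Context: $\mathbf N$ denotes the set of nonnegative integers. For $m\in\mathbf N$, $(q)_m=\prod_{j=1}^m(1-q^j)$, with $(q)_0=1$. The $q$-binomial coefficient is $\begin{bmatrix} m+n\\ m\end{bmatrix}_q=\frac{(q)_{m+n}}{(q)_m(q)_n}$ if $m,n\in\mathbf N$, and it is $0$ otherwise (so $\begin{bmatrix} A\\ B\end{bmatrix}_q=0$ unless $0\le B\le A$). Define $$G(N,M,\alpha,\beta,K,q)=\sum_{j=-\infty}^\infty(-1)^j q^{Kj\frac{(\alpha+\beta)j+(\alpha-\beta)}{2}}\begin{bmatrix} N+M\\ N-Kj\end{bmatrix}_q .$$ The notation $P(q)\ge 0$ means that $P(q)$ is a polynomial in $q$ with nonnegative coefficients. *)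

theory Defs
  imports Complex_Main "HOL-Library.Poly_Mapping" "HOL-Library.Groups_Big_Fun"
    "HOL-Computational_Algebra.Computational_Algebra"
begin

definition qpoch :: "nat \<Rightarrow> int poly" where
  "qpoch m = (\<Prod>j=1..m. 1 - monom 1 j)"

text \<open>
  The fraction in \<open>qbinom\<close> is written with \<open>div\<close> on
  \<^typ>\<open>int poly\<close>; the lemma \<open>qbinom_exact\<close> below shows that the division is exact,
  so that this is the quotient of the two polynomials.
\<close>

definition qbinom :: "int \<Rightarrow> int \<Rightarrow> int poly" where
  "qbinom A B = (if 0 \<le> B \<and> B \<le> A
     then qpoch (nat A) div (qpoch (nat B) * qpoch (nat (A - B))) else 0)"

lemma qpoch_0: "qpoch 0 = 1"
  by (simp add: qpoch_def)

lemma qpoch_Suc: "qpoch (Suc m) = qpoch m * (1 - monom 1 (Suc m))"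
  by (simp add: qpoch_def mult.commute)

lemma qpoch_mult_dvd: "qpoch m * qpoch n dvd qpoch (m + n)"
proof (induction "m + n" arbitrary: m n)
  case 0
  then show ?case by (simp add: qpoch_0)
next
  case (Suc k)
  show ?case
  proof (cases "m = 0 \<or> n = 0")
    case True
    then show ?thesis by (auto simp: qpoch_0)
  next
    case False
    then obtain a b where m: "m = Suc a" and n: "n = Suc b"
      by (meson not0_implies_Suc)
    have k: "k = a + Suc b" "k = Suc a + b" using Suc.hyps(2) m n by simp_all
    have d1: "qpoch a * qpoch (Suc b) dvd qpoch k" using Suc.hyps(1)[OF k(1)] k(1) by simp
    have d2: "qpoch (Suc a) * qpoch b dvd qpoch k" using Suc.hyps(1)[OF k(2)] k(2) by simp
    have split: "(1 :: int poly) - monom 1 (Suc k)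
        = (1 - monom 1 (Suc a)) + monom 1 (Suc a) * (1 - monom 1 (Suc b))"
      using k by (simp add: algebra_simps mult_monom)
    have "qpoch (Suc k) = qpoch k * (1 - monom 1 (Suc a))
        + monom 1 (Suc a) * (qpoch k * (1 - monom 1 (Suc b)))"
      unfolding qpoch_Suc[of k] split by (simp only: algebra_simps)
    moreover have "qpoch (Suc a) * qpoch (Suc b) dvd qpoch k * (1 - monom 1 (Suc a))"
      using mult_dvd_mono[OF d1 dvd_refl[of "1 - monom 1 (Suc a)"]]
      by (simp only: qpoch_Suc[of a] mult_ac)
    moreover have "qpoch (Suc a) * qpoch (Suc b) dvd qpoch k * (1 - monom 1 (Suc b))"
      using mult_dvd_mono[OF d2 dvd_refl[of "1 - monom 1 (Suc b)"]]
      by (simp only: qpoch_Suc[of b] mult_ac)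
    ultimately have "qpoch (Suc a) * qpoch (Suc b) dvd qpoch (Suc k)"
      by (metis dvd_add dvd_mult)
    then show ?thesis using m n Suc.hyps(2) by simp
  qed
qed

lemma qbinom_exact:
  "qbinom (int m + int n) (int m) * (qpoch m * qpoch n) = qpoch (m + n)"
  using qpoch_mult_dvd[of m n] by (simp add: qbinom_def nat_add_distrib)

text \<open>
  The parameters \<open>\<alpha>\<close> and \<open>\<beta>\<close> are rational, so the exponents of \<open>q\<close> in \<open>G\<close> are a priori
  rational numbers. Expressions in \<open>q\<close> therefore live in the ring \<open>rat \<Rightarrow>\<^sub>0 int\<close> of
  finite sums of terms \<open>c q\<^sup>r\<close> (\<open>c\<close> an integer, \<open>r\<close> rational) with \<open>q\<^sup>r = single r 1\<close>.
\<close>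

definition qpow :: "rat \<Rightarrow> rat \<Rightarrow>\<^sub>0 int" where
  "qpow r = Poly_Mapping.single r 1"

definition of_qpoly :: "int poly \<Rightarrow> rat \<Rightarrow>\<^sub>0 int" where
  "of_qpoly p = (\<Sum>i\<le>degree p. of_int (coeff p i) * qpow (of_nat i))"

definition G_term :: "int \<Rightarrow> int \<Rightarrow> rat \<Rightarrow> rat \<Rightarrow> int \<Rightarrow> int \<Rightarrow> rat \<Rightarrow>\<^sub>0 int" where
  "G_term N M \<alpha> \<beta> K j =
     (-1) ^ nat \<bar>j\<bar>
     * qpow (of_int K * of_int j * (((\<alpha> + \<beta>) * of_int j + (\<alpha> - \<beta>)) / 2))
     * of_qpoly (qbinom (N + M) (N - K * j))"

text \<open>
  \<open>Sum_any\<close> adds up the nonzero terms, of which there are finitely many when \<open>K \<noteq> 0\<close>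
  (lemma \<open>finite_G_terms\<close>).
\<close>

definition G :: "int \<Rightarrow> int \<Rightarrow> rat \<Rightarrow> rat \<Rightarrow> int \<Rightarrow> rat \<Rightarrow>\<^sub>0 int" where
  "G N M \<alpha> \<beta> K = Sum_any (G_term N M \<alpha> \<beta> K)"

lemma finite_G_terms:
  assumes "K \<noteq> 0"
  shows "finite {j. G_term N M \<alpha> \<beta> K j \<noteq> 0}"
proof (rule finite_subset)
  show "{j. G_term N M \<alpha> \<beta> K j \<noteq> 0} \<subseteq> (\<lambda>j. N - K * j) -` {0..N + M}"
    by (auto simp: G_term_def qbinom_def of_qpoly_def split: if_splits)
  show "finite ((\<lambda>j. N - K * j) -` {0..N + M})"
    using assms by (intro finite_vimageI) (auto simp: inj_def)
qed

text \<open>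
  \<open>P(q) \<ge> 0\<close>: only exponents in \<open>\<nat>\<close> occur, so that \<open>P\<close> is a polynomial in \<open>q\<close>,
  and all coefficients are nonnegative.
\<close>

definition nonneg_poly :: "(rat \<Rightarrow>\<^sub>0 int) \<Rightarrow> bool" where
  "nonneg_poly P \<longleftrightarrow>
     Poly_Mapping.keys P \<subseteq> \<nat> \<and> (\<forall>r. Poly_Mapping.lookup P r \<ge> 0)"

end

theory Submission
  imports Defs
begin

text \<open>
  Write \<open>T(n) = n(n+1)/2\<close> and \<open>K = 2\<nu> + 1\<close>. Two applications of the \<open>q\<close>-Vandermonde
  sum give the transformation
  \<open>\<Sum>\<^sub>k C(L,k) [k; \<lfloor>(k-n)/2\<rfloor>] = q\<^bsup>T(n)\<^esup> [2L+1; L-n]\<close> with coefficients \<open>C(L,k)\<close> that are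
  visibly nonnegative: both sides equal the sum of
  \<open>q\<^bsup>T(a)+T(b)\<^esup> [L; a] [L; b]\<close> over \<open>a - b \<in> {n, n+1}\<close>.
  Applied with \<open>L + s\<close> in place of \<open>L\<close> and \<open>n = Kj + s\<close>, it writes \<open>q\<^bsup>T(s)\<^esup> G\<close> as a
  nonnegative combination of the finite Andrews--Gordon sums
  \<open>\<Sum>\<^sub>j (-1)\<^sup>j q\<^bsup>j(Kj+2s+1)/2\<^esup> [k; \<lfloor>(k-s-Kj)/2\<rfloor>]\<close>. These are members of the family
  of Andrews, Baxter, Bressoud, Burge, Forrester and Viennot that counts partitions with
  prescribed hook differences, and their positivity follows from Pascal-type recurrences.
\<close>

section \<open>Fractional polynomials\<close>

lemma qpow_0 [simp]: "qpow 0 = 1"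
  by (simp add: qpow_def)

lemma qpow_add: "qpow (a + b) = qpow a * qpow b"
  by (simp add: qpow_def mult_single)

text \<open>The two halves of \<open>nonneg_poly\<close> are tracked separately: coefficients stay
  nonnegative under multiplication by any \<open>qpow r\<close>, including the negative power that
  finally cancels \<open>qpow (tri s)\<close>, while natural exponents are read off the definition
  of \<open>G\<close>.\<close>

definition nonneg_coeffs :: "(rat \<Rightarrow>\<^sub>0 int) \<Rightarrow> bool" where
  "nonneg_coeffs P \<longleftrightarrow> (\<forall>r. Poly_Mapping.lookup P r \<ge> 0)"

definition nat_exponents :: "(rat \<Rightarrow>\<^sub>0 int) \<Rightarrow> bool" where
  "nat_exponents P \<longleftrightarrow> Poly_Mapping.keys P \<subseteq> \<nat>"

lemma nonneg_coeffs_0 [simp]: "nonneg_coeffs 0"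
  by (simp add: nonneg_coeffs_def)

lemma nonneg_coeffs_qpow [simp]: "nonneg_coeffs (qpow r)"
  by (simp add: nonneg_coeffs_def qpow_def lookup_single when_def)

lemma nonneg_coeffs_1 [simp]: "nonneg_coeffs 1"
  using nonneg_coeffs_qpow[of 0] by simp

lemma nonneg_coeffs_add: "nonneg_coeffs P \<Longrightarrow> nonneg_coeffs Q \<Longrightarrow> nonneg_coeffs (P + Q)"
  by (simp add: nonneg_coeffs_def lookup_add)

lemma nonneg_coeffs_sum: "(\<And>x. x \<in> A \<Longrightarrow> nonneg_coeffs (f x)) \<Longrightarrow> nonneg_coeffs (sum f A)"
  by (induction A rule: infinite_finite_induct) (auto intro: nonneg_coeffs_add)

lemma nonneg_coeffs_mult:
  assumes "nonneg_coeffs P" "nonneg_coeffs Q"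
  shows "nonneg_coeffs (P * Q)"
  using assms unfolding nonneg_coeffs_def lookup_mult Sum_any.expand_set
  by (auto intro!: sum_nonneg mult_nonneg_nonneg simp: when_def)

lemma nat_exponents_0 [simp]: "nat_exponents 0"
  by (simp add: nat_exponents_def)

lemma nat_exponents_qpow: "r \<in> \<nat> \<Longrightarrow> nat_exponents (qpow r)"
  by (auto simp: nat_exponents_def qpow_def)

lemma nat_exponents_1 [simp]: "nat_exponents 1"
  using nat_exponents_qpow[of 0] by simp

lemma nat_exponents_add: "nat_exponents P \<Longrightarrow> nat_exponents Q \<Longrightarrow> nat_exponents (P + Q)"
  unfolding nat_exponents_def using keys_add[of P Q] by blast

lemma nat_exponents_uminus: "nat_exponents P \<Longrightarrow> nat_exponents (- P)"
  by (simp add: nat_exponents_def)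

lemma nat_exponents_sum: "(\<And>x. x \<in> A \<Longrightarrow> nat_exponents (f x)) \<Longrightarrow> nat_exponents (sum f A)"
  by (induction A rule: infinite_finite_induct) (auto intro: nat_exponents_add)

lemma nat_exponents_mult:
  assumes "nat_exponents P" "nat_exponents Q"
  shows "nat_exponents (P * Q)"
  using assms keys_mult[of P Q] unfolding nat_exponents_def by (force intro: Nats_add)

section \<open>Integer polynomials embed as a subring of the fractional polynomials\<close>

lemma of_qpoly_eq_sum:
  assumes "degree p \<le> n"
  shows "of_qpoly p = (\<Sum>i\<le>n. of_int (coeff p i) * qpow (of_nat i))"
  unfolding of_qpoly_def using assms
  by (intro sum.mono_neutral_left) (auto simp: coeff_eq_0)

lemma of_qpoly_add: "of_qpoly (p + r) = of_qpoly p + of_qpoly r"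
proof -
  define n where "n = max (degree p) (degree r)"
  have "degree p \<le> n" "degree r \<le> n" "degree (p + r) \<le> n"
    unfolding n_def by (auto intro: degree_add_le)
  then show ?thesis
    by (simp add: of_qpoly_eq_sum[of _ n] sum.distrib distrib_right)
qed

lemma of_qpoly_smult: "of_qpoly (smult c p) = of_int c * of_qpoly p"
proof -
  have "degree (smult c p) \<le> degree p" by simp
  then show ?thesis
    by (simp add: of_qpoly_eq_sum[of _ "degree p"] sum_distrib_left mult.assoc)
qed

lemma of_qpoly_pCons_0: "of_qpoly (pCons 0 p) = qpow 1 * of_qpoly p"
proof -
  have "degree (pCons 0 p) \<le> Suc (degree p)" by (simp add: degree_pCons_le)
  then have "of_qpoly (pCons 0 p)
      = (\<Sum>i\<le>degree p. of_int (coeff p i) * qpow (of_nat (Suc i)))"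
    by (subst of_qpoly_eq_sum[of _ "Suc (degree p)"])
      (simp_all add: sum.atMost_Suc_shift del: sum.atMost_Suc)
  also have "\<dots> = qpow 1 * of_qpoly p"
    by (simp add: of_qpoly_def sum_distrib_left qpow_add mult_ac)
  finally show ?thesis .
qed

lemma of_qpoly_0 [simp]: "of_qpoly 0 = 0"
  by (simp add: of_qpoly_def)

lemma of_qpoly_1 [simp]: "of_qpoly 1 = 1"
  by (simp add: of_qpoly_def)

lemma of_qpoly_mult: "of_qpoly (p * r) = of_qpoly p * of_qpoly r"
proof (induction p)
  case (pCons a p)
  have "of_qpoly (pCons a p) = of_qpoly (smult a 1 + pCons 0 p)" by simp
  also have "\<dots> = of_int a + qpow 1 * of_qpoly p"
    by (simp only: of_qpoly_add of_qpoly_smult of_qpoly_pCons_0 of_qpoly_1 mult_1_right)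
  finally show ?case
    by (simp add: of_qpoly_add of_qpoly_smult of_qpoly_pCons_0 pCons.IH algebra_simps)
qed simp

lemma of_qpoly_monom: "of_qpoly (monom 1 n) = qpow (of_nat n)"
proof (induction n)
  case 0
  then show ?case by (simp add: monom_0 flip: one_pCons)
next
  case (Suc n)
  then show ?case by (simp add: monom_Suc of_qpoly_pCons_0 qpow_add mult.commute)
qed

section \<open>Gaussian binomial coefficients\<close>

lemma qpoch_nonzero [simp]: "qpoch m \<noteq> 0"
proof -
  have "poly (qpoch m) 0 = 1"
    by (auto simp: qpoch_def poly_prod poly_monom intro!: prod.neutral)
  then show ?thesis by auto
qed

lemma qbinom_eq_0: "B < 0 \<or> A < B \<Longrightarrow> qbinom A B = 0"
  by (auto simp: qbinom_def)

lemma qbinom_0_right [simp]: "0 \<le> A \<Longrightarrow> qbinom A 0 = 1"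
  by (simp add: qbinom_def qpoch_0)

lemma qbinom_symmetric: "qbinom A B = qbinom A (A - B)"
  by (auto simp: qbinom_def mult.commute)

lemma qbinom_refl [simp]: "0 \<le> A \<Longrightarrow> qbinom A A = 1"
  using qbinom_symmetric[of A A] by simp

text \<open>Clearing the denominator \<open>qpoch (Suc m) * qpoch (Suc n)\<close> via
  \<open>qbinom_exact\<close> avoids division and leaves (1 - q^(m+1)) + q^(m+1) (1 - q^(n+1)) = 1 -
  q^(m+n+2).\<close>

lemma qbinom_Pascal_nat:
  "qbinom (1 + int m + int n + 1) (int m + 1)
    = qbinom (1 + int m + int n) (int m) + monom 1 (Suc m) * qbinom (1 + int m + int n) (int m + 1)"
  (is "?a = ?b + ?x * ?c")
proof -
  have a: "?a * (qpoch (Suc m) * qpoch (Suc n)) = qpoch (Suc (Suc (m + n)))"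
    using qbinom_exact[of "Suc m" "Suc n"] by (simp add: ac_simps)
  have b: "?b * (qpoch m * qpoch (Suc n)) = qpoch (Suc (m + n))"
    using qbinom_exact[of m "Suc n"] by (simp add: ac_simps)
  have c: "?c * (qpoch (Suc m) * qpoch n) = qpoch (Suc (m + n))"
    using qbinom_exact[of "Suc m" n] by (simp add: ac_simps)
  have "(?b + ?x * ?c) * (qpoch (Suc m) * qpoch (Suc n))
      = (?b * (qpoch m * qpoch (Suc n))) * (1 - monom 1 (Suc m))
        + ?x * ((?c * (qpoch (Suc m) * qpoch n)) * (1 - monom 1 (Suc n)))"
    by (simp only: qpoch_Suc algebra_simps)
  also have "\<dots> = qpoch (Suc (m + n)) * ((1 - monom 1 (Suc m)) + ?x * (1 - monom 1 (Suc n)))"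
    unfolding b c by (simp only: algebra_simps)
  also have "(1 - monom 1 (Suc m)) + ?x * (1 - monom 1 (Suc n))
      = 1 - monom 1 (Suc (Suc (m + n)))"
    by (simp add: algebra_simps mult_monom)
  also have "qpoch (Suc (m + n)) * \<dots> = ?a * (qpoch (Suc m) * qpoch (Suc n))"
    unfolding a by (simp only: qpoch_Suc)
  finally show ?thesis by simp
qed

lemma qbinom_Pascal:
  assumes "A \<ge> 1"
  shows "qbinom A B = qbinom (A - 1) (B - 1) + monom 1 (nat B) * qbinom (A - 1) B"
proof -
  consider "B < 0" | "B = 0" | "B = A" | "A < B" | "0 < B" "B < A" by linarith
  then show ?thesis
  proof cases
    case 5
    then obtain m n where "m = nat (B - 1)" "n = nat (A - B - 1)" by blast
    with 5 have "B = int m + 1" "A = 1 + int m + int n + 1" by auto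
    then show ?thesis using qbinom_Pascal_nat[of m n] by (simp add: nat_add_distrib add.assoc)
  qed (use assms in \<open>auto simp: qbinom_eq_0\<close>)
qed

section \<open>Gaussian binomials with arbitrary integer arguments, as fractional
  polynomials\<close>

definition gauss :: "int \<Rightarrow> int \<Rightarrow> rat \<Rightarrow>\<^sub>0 int" where
  "gauss A B = of_qpoly (qbinom A B)"

lemma gauss_eq_0: "B < 0 \<or> A < B \<Longrightarrow> gauss A B = 0"
  by (simp add: gauss_def qbinom_eq_0)

lemma gauss_0_right [simp]: "0 \<le> A \<Longrightarrow> gauss A 0 = 1"
  by (simp add: gauss_def)

lemma gauss_symmetric: "gauss A B = gauss A (A - B)"
  using qbinom_symmetric by (simp add: gauss_def)

lemma gauss_Pascal:
  assumes "A \<ge> 1"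
  shows "gauss A B = gauss (A - 1) (B - 1) + qpow (of_int B) * gauss (A - 1) B"
proof (cases "B \<ge> 0")
  case True
  then show ?thesis
    using qbinom_Pascal[OF assms, of B]
    by (simp add: gauss_def of_qpoly_add of_qpoly_mult of_qpoly_monom)
qed (simp add: gauss_eq_0)

lemma gauss_Pascal':
  assumes "A \<ge> 1"
  shows "gauss A B = gauss (A - 1) B + qpow (of_int (A - B)) * gauss (A - 1) (B - 1)"
  using gauss_Pascal[OF assms, of "A - B"] gauss_symmetric[of A B]
    gauss_symmetric[of "A - 1" B] gauss_symmetric[of "A - 1" "B - 1"]
  by (simp add: algebra_simps)

lemma gauss_nonneg_nat: "nonneg_coeffs (gauss A B) \<and> nat_exponents (gauss A B)"
proof (induction "nat A" arbitrary: A B)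
  case 0
  then consider "B < 0 \<or> A < B" | "A = 0" "B = 0" by linarith
  then show ?case by cases (simp_all add: gauss_eq_0)
next
  case (Suc n)
  then have A: "A \<ge> 1" "n = nat (A - 1)" by auto
  show ?case
  proof (cases "B \<ge> 0")
    case True
    then have "(of_int B :: rat) \<in> \<nat>"
      by (metis of_int_of_nat_eq of_nat_in_Nats zero_le_imp_eq_int)
    then show ?thesis
      unfolding gauss_Pascal[OF A(1), of B] using Suc.hyps(1)[OF A(2)]
      by (auto intro!: nonneg_coeffs_add nonneg_coeffs_mult nat_exponents_add
          nat_exponents_mult nat_exponents_qpow)
  qed (simp add: gauss_eq_0)
qed

lemma nonneg_coeffs_gauss [simp]: "nonneg_coeffs (gauss A B)"
  and nat_exponents_gauss [simp]: "nat_exponents (gauss A B)"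
  using gauss_nonneg_nat by auto

text \<open>Both sides are the q-multinomial coefficient of \<open>L\<close> with parts
  \<open>m\<close>, \<open>u\<close>, \<open>v\<close>, \<open>w\<close>.\<close>

lemma qbinom_trinomial_nat:
  fixes m u v w :: nat
  defines "L \<equiv> int m + int u + int v + int w"
  shows "qbinom L (int m) * qbinom (L - int m) (int u + int v) * qbinom (int u + int v) (int v)
    = qbinom L (int m + int u) * qbinom (int m + int u) (int m)
        * qbinom (L - int m - int u) (int v)"
    (is "?a1 * ?a2 * ?a3 = ?b1 * ?b2 * ?b3")
proof -
  have a1: "?a1 * (qpoch m * qpoch (u + v + w)) = qpoch (m + u + v + w)"
    using qbinom_exact[of m "u + v + w"] by (simp add: L_def ac_simps)
  have a2: "?a2 * (qpoch (u + v) * qpoch w) = qpoch (u + v + w)"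
    using qbinom_exact[of "u + v" w] by (simp add: L_def ac_simps)
  have a3: "?a3 * (qpoch v * qpoch u) = qpoch (u + v)"
    using qbinom_exact[of v u] by (simp add: L_def ac_simps)
  have b1: "?b1 * (qpoch (m + u) * qpoch (v + w)) = qpoch (m + u + v + w)"
    using qbinom_exact[of "m + u" "v + w"] by (simp add: L_def ac_simps)
  have b2: "?b2 * (qpoch m * qpoch u) = qpoch (m + u)"
    using qbinom_exact[of m u] by (simp add: L_def ac_simps)
  have b3: "?b3 * (qpoch v * qpoch w) = qpoch (v + w)"
    using qbinom_exact[of v w] by (simp add: L_def ac_simps)
  have "?a1 * ?a2 * ?a3 * (qpoch m * qpoch u * qpoch v * qpoch w) = qpoch (m + u + v + w)"
    unfolding a1[symmetric] a2[symmetric] a3[symmetric] by (simp only: mult_ac)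
  moreover have "?b1 * ?b2 * ?b3 * (qpoch m * qpoch u * qpoch v * qpoch w) = qpoch (m + u + v + w)"
    unfolding b1[symmetric] b2[symmetric] b3[symmetric] by (simp only: mult_ac)
  ultimately have "?a1 * ?a2 * ?a3 * (qpoch m * qpoch u * qpoch v * qpoch w)
      = ?b1 * ?b2 * ?b3 * (qpoch m * qpoch u * qpoch v * qpoch w)" by simp
  then show ?thesis by simp
qed

text \<open>The parts of the multinomial are m, a - m, b - m and L - a - b + m; as soon as one of
  them is negative, a factor on each side vanishes.\<close>

lemma gauss_trinomial:
  assumes "0 \<le> a" "a \<le> L" "0 \<le> m"
  shows "gauss L m * gauss (L - m) (a + b - 2 * m) * gauss (a + b - 2 * m) (b - m)
    = gauss L a * gauss a m * gauss (L - a) (b - m)"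
proof (cases "m \<le> a \<and> m \<le> b \<and> b - m \<le> L - a")
  case True
  obtain m' u v w where mu: "m = int m'" "a - m = int u" "b - m = int v" "L - a - b + m = int w"
    using True assms by (metis zero_le_imp_eq_int diff_ge_0_iff_ge diff_diff_eq2 diff_add_eq)
  then have "a = int m' + int u" "b = int m' + int v" "L = int m' + int u + int v + int w"
    by auto
  then show ?thesis
    using qbinom_trinomial_nat[of m' u v w] mu(1)
    by (simp add: gauss_def of_qpoly_mult[symmetric] algebra_simps)
next
  case False
  then show ?thesis using assms by (auto simp: gauss_eq_0 not_le)
qed

text \<open>Induction on \<open>a\<close>: Pascal's rule for \<open>gauss (int (Suc a)) m\<close>
  splits each term into one for \<open>b - 1\<close> with \<open>m\<close> shifted and q^b times one
  for \<open>b\<close>; the two sums recombine by Pascal's rule on the right.\<close>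

lemma gauss_Vandermonde:
  "(\<Sum>m\<in>{0..int a}. qpow (of_int ((int a - m) * (b - m))) * (gauss (int a) m * gauss (int c) (b - m)))
    = gauss (int a + int c) b"
proof (induction a arbitrary: b)
  case 0
  show ?case by (simp)
next
  case (Suc a)
  let ?t = "\<lambda>a b m. qpow (of_int ((int a - m) * (b - m))) * (gauss (int a) m * gauss (int c) (b - m))"
  have P: "gauss (int (Suc a)) m = gauss (int a) (m - 1) + qpow (of_int m) * gauss (int a) m" for m
    using gauss_Pascal[of "int (Suc a)" m] by simp
  have t: "?t (Suc a) b m = ?t a (b - 1) (m - 1) + qpow (of_int b) * ?t a b m" for m
  proof -
    have e: "(of_int ((int (Suc a) - m) * (b - m)) :: rat) = of_int ((int a - (m - 1)) * ((b - 1) - (m - 1)))"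
      by (simp add: algebra_simps)
    have f: "qpow (of_int ((int (Suc a) - m) * (b - m))) * qpow (of_int m)
        = qpow (of_int b) * qpow (of_int ((int a - m) * (b - m)))"
      by (simp add: algebra_simps flip: qpow_add)
    have "?t (Suc a) b m = qpow (of_int ((int (Suc a) - m) * (b - m))) * (gauss (int a) (m - 1) * gauss (int c) (b - m))
       + (qpow (of_int ((int (Suc a) - m) * (b - m))) * qpow (of_int m)) * (gauss (int a) m * gauss (int c) (b - m))"
      unfolding P by (simp only: algebra_simps)
    then show ?thesis unfolding f unfolding e by (simp only: algebra_simps) simp
  qed
  have "(\<Sum>m\<in>{0..int (Suc a)}. ?t (Suc a) b m)
      = (\<Sum>m\<in>{0..int (Suc a)}. ?t a (b - 1) (m - 1)) + qpow (of_int b) * (\<Sum>m\<in>{0..int (Suc a)}. ?t a b m)"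
    unfolding t sum.distrib sum_distrib_left ..
  also have "(\<Sum>m\<in>{0..int (Suc a)}. ?t a (b - 1) (m - 1)) = (\<Sum>m\<in>{0..int a}. ?t a (b - 1) m)"
    by (rule sum.reindex_bij_witness_not_neutral[where i="\<lambda>m. m + 1" and j="\<lambda>m. m - 1"
      and S' = "{0}" and T' = "{}"]) (auto simp: gauss_eq_0)
  also have "\<dots> = gauss (int a + int c) (b - 1)"
    by (rule Suc.IH)
  also have "(\<Sum>m\<in>{0..int (Suc a)}. ?t a b m) = (\<Sum>m\<in>{0..int a}. ?t a b m)"
    by (rule sum.mono_neutral_right) (auto simp: gauss_eq_0)
  also have "\<dots> = gauss (int a + int c) b"
    by (rule Suc.IH)
  finally show ?case using gauss_Pascal[of "int (Suc a) + int c" b] by simp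
qed

section \<open>A positivity-preserving transformation\<close>

text \<open>By \<open>gauss_trinomial\<close> the factor \<open>gauss (int L) a\<close> leaves the
  sum, and q-Vandermonde with L = a + (L - a) evaluates what remains.\<close>

lemma gauss_linearization:
  "(\<Sum>m\<in>{0..int L}. qpow (of_int ((a - m) * (b - m)))
      * (gauss (int L) m * gauss (int L - m) (a + b - 2 * m) * gauss (a + b - 2 * m) (b - m)))
    = gauss (int L) a * gauss (int L) b" (is "?lhs = _")
proof (cases "0 \<le> a \<and> a \<le> int L")
  case True
  have "?lhs = (\<Sum>m\<in>{0..int L}. gauss (int L) a
      * (qpow (of_int ((a - m) * (b - m))) * (gauss a m * gauss (int L - a) (b - m))))"
    using True gauss_trinomial[of a "int L" _ b] by (intro sum.cong refl) (auto simp only: atLeastAtMost_iff mult_ac)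
  also have "\<dots> = gauss (int L) a
      * (\<Sum>m\<in>{0..int L}. qpow (of_int ((a - m) * (b - m))) * (gauss a m * gauss (int L - a) (b - m)))"
    by (simp only: sum_distrib_left)
  also have "(\<Sum>m\<in>{0..int L}. qpow (of_int ((a - m) * (b - m))) * (gauss a m * gauss (int L - a) (b - m)))
      = (\<Sum>m\<in>{0..a}. qpow (of_int ((a - m) * (b - m))) * (gauss a m * gauss (int L - a) (b - m)))"
    using True by (intro sum.mono_neutral_right) (auto simp: gauss_eq_0)
  also have "\<dots> = gauss (int L) b"
    using gauss_Vandermonde[of "nat a" b "nat (int L - a)"] True by simp
  finally show ?thesis .
next
  case False
  \<comment> \<open>If no factor vanished, then m <= a and a + (b - m) <= L with b - m >= 0, which
    forces 0 <= a <= L.\<close>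
  have "gauss (int L) m * gauss (int L - m) (a + b - 2 * m) * gauss (a + b - 2 * m) (b - m) = 0"
    if "m \<ge> 0" for m
  proof (cases "b - m < 0 \<or> a + b - 2 * m < b - m \<or> int L - m < a + b - 2 * m")
    case True
    then show ?thesis by (auto simp: gauss_eq_0)
  next
    case ineq: False
    then show ?thesis using False that by linarith
  qed
  then have "?lhs = 0" by (intro sum.neutral) simp
  then show ?thesis using False by (auto simp: gauss_eq_0 not_le)
qed

definition tri :: "int \<Rightarrow> rat" where
  "tri n = of_int (n * (n + 1)) / 2"

text \<open>These are the coefficients C(L,k). The exponent is T(a) + T(b) + (a - m)(b - m)
  rewritten in terms of m and k = a + b - 2m.\<close>

definition trans_coeff :: "nat \<Rightarrow> int \<Rightarrow> rat \<Rightarrow>\<^sub>0 int" where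
  "trans_coeff L k =
    (\<Sum>m\<in>{0..int L}. qpow (tri m + tri (m + k)) * (gauss (int L) m * gauss (int L - m) k))"

lemma nonneg_coeffs_trans_coeff: "nonneg_coeffs (trans_coeff L k)"
  unfolding trans_coeff_def by (intro nonneg_coeffs_sum nonneg_coeffs_mult) simp_all

text \<open>q-Vandermonde for 2L + 1 = (L + 1) + L, with the summation index reversed to b = L + 1 -
  m; Pascal's rule for \<open>gauss (L + 1) b\<close> then produces the two sums, with index
  differences n and n + 1.\<close>

lemma gauss_2L_plus_1:
  "qpow (tri n) * gauss (2 * int L + 1) (int L - n)
    = (\<Sum>b\<in>{0..int L}. qpow (tri (b + n) + tri b) * (gauss (int L) (b + n) * gauss (int L) b))
      + (\<Sum>b\<in>{0..int L}. qpow (tri (b + n + 1) + tri b) * (gauss (int L) (b + n + 1) * gauss (int L) b))"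
proof -
  let ?L = "int L"
  have expo: "tri n + of_int (b * (b + n)) = tri (b + n) + tri (b - 1)" for b
    by (simp add: tri_def field_simps)
  have flip: "gauss (?L + 1) (?L + 1 - b) = gauss (?L + 1) b" "?L + 1 - b + n = ?L + 1 + n - b" for b
    using gauss_symmetric[of "?L + 1" b] by simp_all
  have "gauss (2 * ?L + 1) (?L - n) = gauss (2 * ?L + 1) (?L + 1 + n)"
    using gauss_symmetric[of "2 * ?L + 1" "?L - n"] by (simp add: algebra_simps)
  also have "\<dots> = (\<Sum>m\<in>{0..?L + 1}. qpow (of_int ((?L + 1 - m) * (?L + 1 + n - m)))
      * (gauss (?L + 1) m * gauss ?L (?L + 1 + n - m)))"
    using gauss_Vandermonde[of "Suc L" "?L + 1 + n" L] by (simp add: algebra_simps)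
  also have "\<dots> = (\<Sum>b\<in>{0..?L + 1}. qpow (of_int (b * (b + n))) * (gauss (?L + 1) b * gauss ?L (b + n)))"
    by (rule sum.reindex_bij_witness[where i = "\<lambda>b. ?L + 1 - b" and j = "\<lambda>b. ?L + 1 - b"])
      (simp_all add: flip)
  finally have "qpow (tri n) * gauss (2 * ?L + 1) (?L - n)
      = (\<Sum>b\<in>{0..?L + 1}. qpow (tri (b + n) + tri (b - 1)) * (gauss (?L + 1) b * gauss ?L (b + n)))"
    by (simp only: sum_distrib_left expo[symmetric] qpow_add mult.assoc)
  also have "\<dots> = (\<Sum>b\<in>{0..?L + 1}. qpow (tri (b + n) + tri b) * (gauss ?L (b + n) * gauss ?L b))
      + (\<Sum>b\<in>{0..?L + 1}. qpow (tri (b + n) + tri (b - 1)) * (gauss ?L (b + n) * gauss ?L (b - 1)))"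
    (is "_ = ?A + ?B")
  proof -
    have "qpow (tri (b + n) + tri (b - 1)) * (gauss (?L + 1) b * gauss ?L (b + n))
      = qpow (tri (b + n) + tri b) * (gauss ?L (b + n) * gauss ?L b)
        + qpow (tri (b + n) + tri (b - 1)) * (gauss ?L (b + n) * gauss ?L (b - 1))" for b
    proof -
      have e: "tri (b + n) + tri b = tri (b + n) + tri (b - 1) + of_int b"
        by (simp add: tri_def field_simps)
      show ?thesis
        using gauss_Pascal[of "?L + 1" b] unfolding e qpow_add by (simp add: algebra_simps)
    qed
    then show ?thesis by (simp add: sum.distrib)
  qed
  also have "?A = (\<Sum>b\<in>{0..?L}. qpow (tri (b + n) + tri b) * (gauss ?L (b + n) * gauss ?L b))"
    by (rule sum.mono_neutral_right) (auto simp: gauss_eq_0)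
  also have "?B = (\<Sum>b\<in>{0..?L}. qpow (tri (b + n + 1) + tri b) * (gauss ?L (b + n + 1) * gauss ?L b))"
    by (rule sum.reindex_bij_witness_not_neutral[where i = "\<lambda>b. b + 1" and j = "\<lambda>b. b - 1"
      and S' = "{0}" and T' = "{}"]) (auto simp: gauss_eq_0 algebra_simps)
  finally show ?thesis .
qed

text \<open>Linearizing a product with a - b = n + d, where d is 0 or 1, gives k = n + d + 2(b - m).
  Hence the floor of (k - n)/2 is b - m and the parity of k - n recovers d, so one sum over k
  collects both index differences.\<close>

theorem gauss_transformation:
  "(\<Sum>k\<in>{0..int L}. trans_coeff L k * gauss k ((k - n) div 2))
    = qpow (tri n) * gauss (2 * int L + 1) (int L - n)"
proof -
  let ?L = "int L"
  define t where "t m k = qpow (tri m + tri (m + k))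
    * (gauss ?L m * gauss (?L - m) k * gauss k ((k - n) div 2))" for m k
  have prod: "qpow (tri (b + n + d) + tri b) * (gauss ?L (b + n + d) * gauss ?L b)
      = (\<Sum>m\<in>{0..?L}. t m (n + d + 2 * (b - m)))" if "d \<in> {0, 1}" for b d
  proof -
    define a where "a = b + n + d"
    have k: "n + d + 2 * (b - m) = a + b - 2 * m" "(a + b - 2 * m - n) div 2 = b - m" for m
      using that by (auto simp: a_def)
    have e: "tri a + tri b + of_int ((a - m) * (b - m)) = tri m + tri (m + (a + b - 2 * m))" for m
      by (simp add: tri_def field_simps)
    have "qpow (tri a + tri b) * (gauss ?L a * gauss ?L b) = (\<Sum>m\<in>{0..?L}. t m (a + b - 2 * m))"
      unfolding gauss_linearization[symmetric] sum_distrib_left t_def k e[symmetric] qpow_add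
      by (simp only: mult_ac)
    then show ?thesis unfolding k(1) a_def .
  qed
  \<comment> \<open>The two index ranges do not match exactly; the bijection is only between nonzero
    terms, so \<open>S'\<close> and \<open>T'\<close> discard the zero ones.\<close>
  have reindex: "(\<Sum>k\<in>{0..?L}. t m k) = (\<Sum>(b, d)\<in>{0..?L} \<times> {0, 1}. t m (n + d + 2 * (b - m)))"
    if m: "m \<in> {0..?L}" for m
  proof (rule sum.reindex_bij_witness_not_neutral[where
      i = "\<lambda>(b, d). n + d + 2 * (b - m)" and j = "\<lambda>k. (m + (k - n) div 2, (k - n) mod 2)"
      and S' = "{k \<in> {0..?L}. t m k = 0}"
      and T' = "{(b, d) \<in> {0..?L} \<times> {0, 1}. t m (n + d + 2 * (b - m)) = 0}"])
    show "finite {k \<in> {0..?L}. t m k = 0}"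
      by (rule finite_subset[of _ "{0..?L}"]) auto
    show "finite {(b, d) \<in> {0..?L} \<times> {0, 1}. t m (n + d + 2 * (b - m)) = 0}"
      by (rule finite_subset[of _ "{0..?L} \<times> {0, 1}"]) auto
  next
    fix k assume k: "k \<in> {0..?L} - {k \<in> {0..?L}. t m k = 0}"
    then have "t m k \<noteq> 0" by simp
    then have "gauss (?L - m) k \<noteq> 0" "gauss k ((k - n) div 2) \<noteq> 0" by (auto simp: t_def)
    then have "k \<le> ?L - m" "0 \<le> (k - n) div 2" "(k - n) div 2 \<le> k"
      by (meson gauss_eq_0 not_le)+
    moreover have "n + (k - n) mod 2 + 2 * (m + (k - n) div 2 - m) = k"
      by presburger
    ultimately show "(m + (k - n) div 2, (k - n) mod 2) \<in> {0..?L} \<times> {0, 1}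
        - {(b, d) \<in> {0..?L} \<times> {0, 1}. t m (n + d + 2 * (b - m)) = 0}"
      using k m by auto
    show "(case (m + (k - n) div 2, (k - n) mod 2) of (b, d) \<Rightarrow> n + d + 2 * (b - m)) = k"
      unfolding prod.case by presburger
  next
    fix x assume x: "x \<in> {0..?L} \<times> {0, 1} - {(b, d) \<in> {0..?L} \<times> {0, 1}. t m (n + d + 2 * (b - m)) = 0}"
    obtain b d where bd: "x = (b, d)" by force
    define k where "k = n + d + 2 * (b - m)"
    have d: "d = 0 \<or> d = 1" and t: "t m k \<noteq> 0" using x bd by (auto simp: k_def)
    have halves: "(n + d + 2 * (b - m) - n) div 2 = b - m" "(n + d + 2 * (b - m) - n) mod 2 = d"
      using d by presburger+
    have "k \<le> ?L - m" "0 \<le> k" using t gauss_eq_0[of k "?L - m"] by (auto simp: t_def not_le[symmetric])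
    then show "(case x of (b, d) \<Rightarrow> n + d + 2 * (b - m)) \<in> {0..?L} - {k \<in> {0..?L}. t m k = 0}"
      using t m by (simp add: bd k_def)
    show "(m + ((case x of (b, d) \<Rightarrow> n + d + 2 * (b - m)) - n) div 2,
        ((case x of (b, d) \<Rightarrow> n + d + 2 * (b - m)) - n) mod 2) = x"
      unfolding bd prod.case halves by simp
  qed (auto simp: case_prod_beta)
  have "(\<Sum>k\<in>{0..?L}. trans_coeff L k * gauss k ((k - n) div 2)) = (\<Sum>k\<in>{0..?L}. \<Sum>m\<in>{0..?L}. t m k)"
    by (simp only: trans_coeff_def sum_distrib_right t_def mult.assoc)
  also have "\<dots> = (\<Sum>m\<in>{0..?L}. \<Sum>k\<in>{0..?L}. t m k)"
    by (rule sum.swap)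
  also have "\<dots> = (\<Sum>m\<in>{0..?L}. \<Sum>(b, d)\<in>{0..?L} \<times> {0, 1}. t m (n + d + 2 * (b - m)))"
    using reindex by (rule sum.cong[OF refl])
  also have "\<dots> = (\<Sum>(b, d)\<in>{0..?L} \<times> {0, 1}. \<Sum>m\<in>{0..?L}. t m (n + d + 2 * (b - m)))"
    unfolding case_prod_beta by (rule sum.swap)
  also have "\<dots> = (\<Sum>(b, d)\<in>{0..?L} \<times> {0, 1}.
      qpow (tri (b + n + d) + tri b) * (gauss ?L (b + n + d) * gauss ?L b))"
  proof (rule sum.cong[OF refl])
    fix x :: "int \<times> int" assume "x \<in> {0..?L} \<times> {0, 1}"
    then have "snd x \<in> {0, 1}" by auto
    from prod[OF this, of "fst x"]
    show "(case x of (b, d) \<Rightarrow> \<Sum>m\<in>{0..?L}. t m (n + d + 2 * (b - m)))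
        = (case x of (b, d) \<Rightarrow> qpow (tri (b + n + d) + tri b) * (gauss ?L (b + n + d) * gauss ?L b))"
      by (simp only: case_prod_beta)
  qed
  also have "\<dots> = qpow (tri n) * gauss (2 * ?L + 1) (?L - n)"
    unfolding gauss_2L_plus_1 sum.cartesian_product[symmetric] by (simp add: sum.distrib)
  finally show ?thesis .
qed

section \<open>Alternating sums of Gaussian binomials\<close>

text \<open>
  In the notation of those authors, with \<open>\<alpha> + \<beta> = 2\<close>, \<open>box_sum\<close> is their \<open>D\<^bsub>K,i\<^esub>(N,M;\<alpha>,\<beta>)\<close>,
  with the summation index \<open>\<mu>\<close> replaced by \<open>n = K\<mu>\<close> in the positive terms and by
  \<open>n = K\<mu> - i\<close> in the negative ones.
\<close>

definition box_term :: "int \<Rightarrow> int \<Rightarrow> int \<Rightarrow> int \<Rightarrow> int \<Rightarrow> int \<Rightarrow> rat \<Rightarrow>\<^sub>0 int" where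
  "box_term K i \<beta> N M n =
    (of_bool (K dvd n) - of_bool (K dvd n + i))
    * (qpow (2 * of_int (n * (n + i)) / of_int K - of_int (\<beta> * n)) * gauss (N + M) (N - n))"

definition box_sum :: "int \<Rightarrow> int \<Rightarrow> int \<Rightarrow> int \<Rightarrow> int \<Rightarrow> rat \<Rightarrow>\<^sub>0 int" where
  "box_sum K i \<beta> N M = (\<Sum>n\<in>{-M..N}. box_term K i \<beta> N M n)"

lemma box_sum_superset:
  assumes "finite A" "{-M..N} \<subseteq> A"
  shows "box_sum K i \<beta> N M = (\<Sum>n\<in>A. box_term K i \<beta> N M n)"
  unfolding box_sum_def using assms
  by (intro sum.mono_neutral_left) (auto simp: box_term_def gauss_eq_0)

text \<open>Pascal's rule contributes q^(M+n): the factor q^M leaves the sum and q^n lowers \<beta>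
  by one.\<close>

lemma box_sum_Pascal:
  assumes "N + M \<ge> 1"
  shows "box_sum K i \<beta> N M
    = box_sum K i \<beta> N (M - 1) + qpow (of_int M) * box_sum K i (\<beta> - 1) (N - 1) M"
proof -
  have "box_term K i \<beta> N M n
      = box_term K i \<beta> N (M - 1) n + qpow (of_int M) * box_term K i (\<beta> - 1) (N - 1) M n" for n
  proof -
    define e :: rat where "e = 2 * of_int (n * (n + i)) / of_int K"
    have expo: "e - of_int (\<beta> * n) + of_int (N + M - (N - n)) = of_int M + (e - of_int ((\<beta> - 1) * n))"
      by (simp add: algebra_simps)
    have P: "gauss (N + M) (N - n)
        = gauss (N + (M - 1)) (N - n) + qpow (of_int (N + M - (N - n))) * gauss (N - 1 + M) (N - 1 - n)"
      using gauss_Pascal'[OF assms, of "N - n"] by (simp add: algebra_simps)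
    have "qpow (e - of_int (\<beta> * n)) * gauss (N + M) (N - n)
        = qpow (e - of_int (\<beta> * n)) * gauss (N + (M - 1)) (N - n)
          + qpow (of_int M) * (qpow (e - of_int ((\<beta> - 1) * n)) * gauss (N - 1 + M) (N - 1 - n))"
      unfolding P distrib_left mult.assoc[symmetric] qpow_add[symmetric] expo ..
    then show ?thesis unfolding box_term_def e_def[symmetric] by (simp only: distrib_left mult_ac)
  qed
  then show ?thesis
    by (simp add: box_sum_superset[of "{-M..N}"] sum.distrib sum_distrib_left)
qed

text \<open>The other Pascal rule contributes q^(N-n), so here \<beta> rises by one.\<close>

lemma box_sum_Pascal':
  assumes "N + M \<ge> 1"
  shows "box_sum K i \<beta> N M
    = box_sum K i \<beta> (N - 1) M + qpow (of_int N) * box_sum K i (\<beta> + 1) N (M - 1)"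
proof -
  have "box_term K i \<beta> N M n
      = box_term K i \<beta> (N - 1) M n + qpow (of_int N) * box_term K i (\<beta> + 1) N (M - 1) n" for n
  proof -
    define e :: rat where "e = 2 * of_int (n * (n + i)) / of_int K"
    have expo: "e - of_int (\<beta> * n) + of_int (N - n) = of_int N + (e - of_int ((\<beta> + 1) * n))"
      by (simp add: algebra_simps)
    have P: "gauss (N + M) (N - n)
        = gauss (N - 1 + M) (N - 1 - n) + qpow (of_int (N - n)) * gauss (N + (M - 1)) (N - n)"
      using gauss_Pascal[OF assms, of "N - n"] by (simp add: algebra_simps)
    have "qpow (e - of_int (\<beta> * n)) * gauss (N + M) (N - n)
        = qpow (e - of_int (\<beta> * n)) * gauss (N - 1 + M) (N - 1 - n)
          + qpow (of_int N) * (qpow (e - of_int ((\<beta> + 1) * n)) * gauss (N + (M - 1)) (N - n))"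
      unfolding P distrib_left mult.assoc[symmetric] qpow_add[symmetric] expo ..
    then show ?thesis unfolding box_term_def e_def[symmetric] by (simp only: distrib_left mult_ac)
  qed
  then show ?thesis
    by (simp add: box_sum_superset[of "{-M..N}"] sum.distrib sum_distrib_left)
qed

lemma eq_neg_self_imp_0:
  fixes P :: "rat \<Rightarrow>\<^sub>0 int"
  assumes "P = - P"
  shows "P = 0"
proof (rule poly_mapping_eqI)
  fix r
  have "Poly_Mapping.lookup P r = Poly_Mapping.lookup (- P) r" using assms by (rule arg_cong)
  then show "Poly_Mapping.lookup P r = Poly_Mapping.lookup 0 r" by simp
qed

text \<open>The reflection n -> -i - n swaps the two divisibility conditions and fixes n(n + i);
  since N - M = -i it also fixes the binomial. The sum is therefore its own negative.\<close>

lemma box_sum_boundary_0: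
  assumes "N - M = - i"
  shows "box_sum K i 0 N M = 0"
proof (rule eq_neg_self_imp_0)
  have refl: "box_term K i 0 N M (- i - n) = - box_term K i 0 N M n" for n
  proof -
    have "gauss (N + M) (N - (- i - n)) = gauss (N + M) (N - n)"
    proof -
      have "N - (- i - n) = N + M - (N - n)" using assms by simp
      with gauss_symmetric[of "N + M" "N - n"] show ?thesis by (simp only:)
    qed
    moreover have "K dvd - i - n \<longleftrightarrow> K dvd n + i"
      using dvd_minus_iff[of K "n + i"] by (simp add: algebra_simps)
    ultimately show ?thesis by (simp add: box_term_def algebra_simps)
  qed
  have "box_sum K i 0 N M = (\<Sum>n\<in>{-M..N}. box_term K i 0 N M (- i - n))"
    unfolding box_sum_def using assms
    by (intro sum.reindex_bij_witness[where i = "\<lambda>n. - i - n" and j = "\<lambda>n. - i - n"]) auto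
  then show "box_sum K i 0 N M = - box_sum K i 0 N M"
    unfolding refl sum_negf box_sum_def .
qed

text \<open>The same argument with n -> K - i - n, which preserves the exponent 2n(n + i)/K -
  2n.\<close>

lemma box_sum_boundary_2:
  assumes "K \<noteq> 0" "N - M = K - i"
  shows "box_sum K i 2 N M = 0"
proof (rule eq_neg_self_imp_0)
  have refl: "box_term K i 2 N M (K - i - n) = - box_term K i 2 N M n" for n
  proof -
    have "gauss (N + M) (N - (K - i - n)) = gauss (N + M) (N - n)"
    proof -
      have "N - (K - i - n) = N + M - (N - n)" using assms(2) by simp
      with gauss_symmetric[of "N + M" "N - n"] show ?thesis by (simp only:)
    qed
    moreover have "K dvd K - i - n \<longleftrightarrow> K dvd n + i"
    proof -
      have "K - i - n = K - (n + i)" by simp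
      then show ?thesis by (simp only: dvd_diff_right_iff[OF dvd_refl])
    qed
    moreover have "K dvd K - i - n + i \<longleftrightarrow> K dvd n"
    proof -
      have "K - i - n + i = K - n" by simp
      then show ?thesis by (simp only: dvd_diff_right_iff[OF dvd_refl])
    qed
    moreover have "2 * of_int ((K - i - n) * (K - i - n + i)) / of_int K - of_int (2 * (K - i - n))
        = 2 * of_int (n * (n + i)) / of_int K - (of_int (2 * n) :: rat)"
      using assms(1) by (simp add: field_simps)
    ultimately have "box_term K i 2 N M (K - i - n) = (of_bool (K dvd n + i) - of_bool (K dvd n))
        * (qpow (2 * of_int (n * (n + i)) / of_int K - of_int (2 * n)) * gauss (N + M) (N - n))"
      unfolding box_term_def by (simp only:)
    then show ?thesis by (simp only: box_term_def left_diff_distrib minus_diff_eq)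
  qed
  have "box_sum K i 2 N M = (\<Sum>n\<in>{-M..N}. box_term K i 2 N M (K - i - n))"
    unfolding box_sum_def using assms(2)
    by (intro sum.reindex_bij_witness[where i = "\<lambda>n. K - i - n" and j = "\<lambda>n. K - i - n"]) auto
  then show "box_sum K i 2 N M = - box_sum K i 2 N M"
    unfolding refl sum_negf box_sum_def .
qed

lemma not_dvd_between:
  fixes K n :: int
  assumes "0 < n" "n < K"
  shows "\<not> K dvd n"
  using assms zdvd_imp_le by force

text \<open>In this strip N < 0 confines n to -i < n < 0, and otherwise M < 0 confines it to 0 < n <
  K - i. In both ranges neither n nor n + i is a multiple of K.\<close>

lemma box_sum_eq_0:
  assumes "0 < i" "i < K" "-i \<le> N - M" "N - M \<le> K - i" "N < 0 \<or> M < 0"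
  shows "box_sum K i \<beta> N M = 0"
  unfolding box_sum_def
proof (rule sum.neutral, rule ballI)
  fix n assume n: "n \<in> {-M..N}"
  have "\<not> K dvd n \<and> \<not> K dvd n + i"
  proof (cases "N < 0")
    case True
    have "\<not> K dvd - n"
      by (rule not_dvd_between) (use True n assms in auto)
    moreover have "\<not> K dvd n + i"
      by (rule not_dvd_between) (use True n assms in auto)
    ultimately show ?thesis by simp
  next
    case False
    then have "\<not> K dvd n" "\<not> K dvd n + i"
      by (rule_tac not_dvd_between; use n assms in auto)+
    then show ?thesis by simp
  qed
  then show "box_term K i \<beta> N M n = 0" by (simp add: box_term_def)
qed

text \<open>
  The three families are closed under the two Pascal recurrences; the intervals for \<open>N - M\<close>
  end where the \<open>\<beta> = 0\<close> and \<open>\<beta> = 2\<close> families vanish by reflection, so no negative term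
  ever enters.
\<close>

lemma nonneg_box_sum:
  assumes "0 < i" "i < K" "3 \<le> K"
  shows "(-i + 1 \<le> N - M \<and> N - M \<le> K - i - 1 \<longrightarrow> nonneg_coeffs (box_sum K i 1 N M))
    \<and> (-i \<le> N - M \<and> N - M \<le> K - i - 2 \<longrightarrow> nonneg_coeffs (box_sum K i 0 N M))
    \<and> (-i + 2 \<le> N - M \<and> N - M \<le> K - i \<longrightarrow> nonneg_coeffs (box_sum K i 2 N M))"
proof (induction "nat (N + M)" arbitrary: N M rule: less_induct)
  case less
  consider "N < 0 \<or> M < 0" | "N = 0" "M = 0" | "N \<ge> 0" "M \<ge> 0" "N + M \<ge> 1"
    by linarith
  then show ?case
  proof cases
    case 1
    then show ?thesis using box_sum_eq_0[OF assms(1,2) _ _ 1] by auto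
  next
    case 2
    \<comment> \<open>Only n = 0 occurs, and its term is 1 because K does not divide i.\<close>
    then show ?thesis
      using not_dvd_between[OF assms(1,2)] by (simp add: box_sum_def box_term_def)
  next
    case 3
    then have "nat (N + (M - 1)) < nat (N + M)" "nat (N - 1 + M) < nat (N + M)" by auto
    note IH = less.hyps[OF this(1)] less.hyps[OF this(2)]
    note intros = nonneg_coeffs_add nonneg_coeffs_mult nonneg_coeffs_qpow
    have "nonneg_coeffs (box_sum K i 1 N M)" if "-i + 1 \<le> N - M" "N - M \<le> K - i - 1"
    \<comment> \<open>At the right end the first recurrence would leave the \<beta> = 1 strip; the
      second one moves to N - M = K - i with \<beta> = 2, and K >= 3 keeps its other term in the
      strip.\<close>
    proof (cases "N - M < K - i - 1")
      case True
      then show ?thesis unfolding box_sum_Pascal[OF 3(3), of K i 1]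
        using IH that by (auto intro!: intros)
    next
      case False
      then show ?thesis unfolding box_sum_Pascal'[OF 3(3), of K i 1]
        using IH that assms(3) by (auto intro!: intros)
    qed
    moreover have "nonneg_coeffs (box_sum K i 0 N M)" if "-i \<le> N - M" "N - M \<le> K - i - 2"
    proof (cases "N - M = -i")
      case True
      then show ?thesis using box_sum_boundary_0 assms by simp
    next
      case False
      then show ?thesis unfolding box_sum_Pascal'[OF 3(3), of K i 0]
        using IH that by (auto intro!: intros)
    qed
    moreover have "nonneg_coeffs (box_sum K i 2 N M)" if "-i + 2 \<le> N - M" "N - M \<le> K - i"
    proof (cases "N - M = K - i")
      case True
      then show ?thesis using box_sum_boundary_2 assms by simp
    next
      case False
      then show ?thesis unfolding box_sum_Pascal[OF 3(3), of K i 2]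
        using IH that by (auto intro!: intros)
    qed
    ultimately show ?thesis by blast
  qed
qed

text \<open>Split by the parity of j: j = 2\<mu> gives the positive terms at n = K\<mu>, and j = 1 -
  2\<mu> the negative ones at n = K\<mu> - i. \<open>J\<close> is any finite set containing the
  support.\<close>

lemma andrews_gordon_sum:
  fixes K k s \<nu> :: int and J :: "int set"
  defines "K \<equiv> 2 * \<nu> + 1" and "N \<equiv> (k - s) div 2"
  assumes "\<nu> \<ge> 1" "finite J"
    and J: "\<And>j. 0 \<le> (k - (K * j + s)) div 2 \<Longrightarrow> (k - (K * j + s)) div 2 \<le> k \<Longrightarrow> j \<in> J"
  shows "(\<Sum>j\<in>J. (-1) ^ nat \<bar>j\<bar>
      * (qpow (of_int (j * (K * j + 2 * s + 1)) / 2) * gauss k ((k - (K * j + s)) div 2)))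
    = box_sum K (\<nu> + s + 1) 1 N (k - N)"
proof -
  define i where "i = \<nu> + s + 1"
  define M where "M = k - N"
  define g where "g j = qpow (of_int (j * (K * j + 2 * s + 1)) / 2) * gauss k ((k - (K * j + s)) div 2)" for j
  define h where "h n = qpow (2 * of_int (n * (n + i)) / of_int K - of_int n) * gauss k (N - n)" for n
  define J0 where "J0 = {j. 0 \<le> (k - (K * j + s)) div 2 \<and> (k - (K * j + s)) div 2 \<le> k}"
  have K: "K > 0" using assms(3) by (simp add: K_def)
  have J0: "J0 \<subseteq> J" using J by (auto simp: J0_def)
  then have fin: "finite J0" using \<open>finite J\<close> finite_subset by blast
  have even_div: "(k - (K * (2 * \<mu>) + s)) div 2 = N - K * \<mu>" for \<mu>
  proof -
    have "k - (K * (2 * \<mu>) + s) = (k - s) + (- (K * \<mu>)) * 2" by simp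
    then show ?thesis unfolding N_def by (simp only: div_mult_self1)
  qed
  \<comment> \<open>As K is odd, odd j changes the parity under the floor. The floors of (k-s-1)/2
    and (k-s)/2 add up to k-s-1, so the lower index is a complement in k; this dictates i = \<nu> +
    s + 1.\<close>
  have odd_div: "(k - (K * (1 - 2 * \<mu>) + s)) div 2 = k - (N - (K * \<mu> - i))" for \<mu>
  proof -
    have "k - (K * (1 - 2 * \<mu>) + s) = (k - s - 1) + (K * \<mu> - \<nu>) * 2"
      by (simp add: K_def algebra_simps)
    then have "(k - (K * (1 - 2 * \<mu>) + s)) div 2 = (k - s - 1) div 2 + (K * \<mu> - \<nu>)" by simp
    moreover have "(k - s - 1) div 2 + (k - s) div 2 = k - s - 1" by presburger
    ultimately show ?thesis by (simp add: N_def i_def)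
  qed
  have g_even: "g (2 * \<mu>) = h (K * \<mu>)" for \<mu>
  proof -
    have "of_int (2 * \<mu> * (K * (2 * \<mu>) + 2 * s + 1)) / 2
        = 2 * of_int (K * \<mu> * (K * \<mu> + i)) / of_int K - (of_int (K * \<mu>) :: rat)"
      using K by (simp add: field_simps) (simp add: i_def K_def algebra_simps)
    then show ?thesis unfolding g_def h_def even_div by simp
  qed
  have g_odd: "g (1 - 2 * \<mu>) = h (K * \<mu> - i)" for \<mu>
  proof -
    have "of_int ((1 - 2 * \<mu>) * (K * (1 - 2 * \<mu>) + 2 * s + 1)) / 2
        = 2 * of_int ((K * \<mu> - i) * (K * \<mu> - i + i)) / of_int K - (of_int (K * \<mu> - i) :: rat)"
      using K by (simp add: field_simps) (simp add: i_def K_def algebra_simps)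
    with gauss_symmetric[of k "N - (K * \<mu> - i)"] show ?thesis
      unfolding g_def h_def odd_div by (simp only:)
  qed
  have "(\<Sum>j\<in>J. (-1) ^ nat \<bar>j\<bar> * g j) = (\<Sum>j\<in>J0. (-1) ^ nat \<bar>j\<bar> * g j)"
    using J0 \<open>finite J\<close>
    by (intro sum.mono_neutral_right) (auto simp: g_def J0_def gauss_eq_0 not_le)
  also have "\<dots> = (\<Sum>j\<in>J0. if even j then g j else - g j)"
    by (intro sum.cong refl) (auto simp: even_nat_iff)
  also have "\<dots> = (\<Sum>j\<in>J0 \<inter> {j. even j}. g j) - (\<Sum>j\<in>J0 \<inter> - {j. even j}. g j)"
    by (simp add: sum.If_cases[OF fin] sum_negf)
  also have "(\<Sum>j\<in>J0 \<inter> {j. even j}. g j) = (\<Sum>n\<in>{n\<in>{-M..N}. K dvd n}. h n)"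
  proof (rule sum.reindex_bij_witness[where i = "\<lambda>n. 2 * (n div K)" and j = "\<lambda>j. K * (j div 2)"])
    fix j assume j: "j \<in> J0 \<inter> {j. even j}"
    then obtain \<mu> where \<mu>: "j = 2 * \<mu>" by (auto elim: evenE)
    show "2 * (K * (j div 2) div K) = j" using K \<mu> by simp
    show "K * (j div 2) \<in> {n\<in>{-M..N}. K dvd n}"
      using j unfolding \<mu> J0_def Int_iff mem_Collect_eq even_div M_def by simp
    show "h (K * (j div 2)) = g j" by (simp add: \<mu> g_even)
  next
    fix n assume n: "n \<in> {n\<in>{-M..N}. K dvd n}"
    then obtain \<mu> where \<mu>: "n = K * \<mu>" by (auto elim: dvdE)
    show "K * (2 * (n div K) div 2) = n" using K by (simp add: \<mu>)
    have "2 * \<mu> \<in> J0" using n unfolding \<mu> J0_def mem_Collect_eq even_div M_def by simp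
    then show "2 * (n div K) \<in> J0 \<inter> {j. even j}" using K by (simp add: \<mu>)
  qed
  also have "(\<Sum>j\<in>J0 \<inter> - {j. even j}. g j) = (\<Sum>n\<in>{n\<in>{-M..N}. K dvd n + i}. h n)"
  proof (rule sum.reindex_bij_witness[where i = "\<lambda>n. 1 - 2 * ((n + i) div K)"
      and j = "\<lambda>j. K * ((1 - j) div 2) - i"])
    fix j assume j: "j \<in> J0 \<inter> - {j. even j}"
    then obtain m where "j = 2 * m + 1" by (auto elim: oddE)
    then have "j = 1 - 2 * (- m)" by simp
    then obtain \<mu> where \<mu>: "j = 1 - 2 * \<mu>" ..
    have half: "(1 - (1 - 2 * \<mu>)) div 2 = \<mu>" by simp
    show "1 - 2 * ((K * ((1 - j) div 2) - i + i) div K) = j" using K \<mu> by simp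
    show "K * ((1 - j) div 2) - i \<in> {n\<in>{-M..N}. K dvd n + i}"
      using j unfolding \<mu> half J0_def Int_iff mem_Collect_eq odd_div M_def by simp
    show "h (K * ((1 - j) div 2) - i) = g j" by (simp add: \<mu> g_odd)
  next
    fix n assume n: "n \<in> {n\<in>{-M..N}. K dvd n + i}"
    then obtain \<mu> where "n + i = K * \<mu>" by (auto elim: dvdE)
    then have \<mu>: "n = K * \<mu> - i" by simp
    show "K * ((1 - (1 - 2 * ((n + i) div K))) div 2) - i = n" using K by (simp add: \<mu>)
    have "1 - 2 * \<mu> \<in> J0" using n unfolding \<mu> J0_def mem_Collect_eq odd_div M_def by simp
    then show "1 - 2 * ((n + i) div K) \<in> J0 \<inter> - {j. even j}" using K by (simp add: \<mu>)
  qed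
  also have "(\<Sum>n\<in>{n\<in>{-M..N}. K dvd n}. h n) - (\<Sum>n\<in>{n\<in>{-M..N}. K dvd n + i}. h n)
      = (\<Sum>n\<in>{-M..N}. (of_bool (K dvd n) - of_bool (K dvd n + i)) * h n)"
  proof -
    have "(\<Sum>n\<in>{n\<in>{-M..N}. P n}. h n) = (\<Sum>n\<in>{-M..N}. of_bool (P n) * h n)" for P
      by (rule sum.mono_neutral_cong_left) auto
    then show ?thesis by (simp only: left_diff_distrib sum_subtractf)
  qed
  finally show ?thesis
    by (simp add: box_sum_def box_term_def g_def h_def i_def M_def)
qed

lemma nonneg_andrews_gordon_sum:
  fixes K k s \<nu> :: int and J :: "int set"
  defines "K \<equiv> 2 * \<nu> + 1"
  assumes "0 \<le> s" "s < \<nu>" "finite J"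
    and J: "\<And>j. 0 \<le> (k - (K * j + s)) div 2 \<Longrightarrow> (k - (K * j + s)) div 2 \<le> k \<Longrightarrow> j \<in> J"
  shows "nonneg_coeffs (\<Sum>j\<in>J. (-1) ^ nat \<bar>j\<bar>
      * (qpow (of_int (j * (K * j + 2 * s + 1)) / 2) * gauss k ((k - (K * j + s)) div 2)))"
proof -
  let ?N = "(k - s) div 2"
  \<comment> \<open>Both values lie in the \<beta> = 1 strip because \<nu> >= 1, while s < \<nu>
    amounts to i < K.\<close>
  have "?N - (k - ?N) = - s \<or> ?N - (k - ?N) = - s - 1" by presburger
  then have "- (\<nu> + s + 1) + 1 \<le> ?N - (k - ?N) \<and> ?N - (k - ?N) \<le> K - (\<nu> + s + 1) - 1"
    using assms(2,3) by (auto simp: K_def)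
  then have "nonneg_coeffs (box_sum K (\<nu> + s + 1) 1 ?N (k - ?N))"
    using nonneg_box_sum[of "\<nu> + s + 1" K] assms(2,3) by (auto simp: K_def)
  moreover have "(\<Sum>j\<in>J. (-1) ^ nat \<bar>j\<bar>
      * (qpow (of_int (j * (K * j + 2 * s + 1)) / 2) * gauss k ((k - (K * j + s)) div 2)))
    = box_sum K (\<nu> + s + 1) 1 ?N (k - ?N)"
    unfolding K_def
    by (rule andrews_gordon_sum) (use assms(2-4) in simp_all, rule J, simp_all add: K_def)
  ultimately show ?thesis by simp
qed

section \<open>Positivity of G by reduction to Andrews-Gordon sums\<close>

theorem theorem1p2:
  fixes L \<nu> s :: nat
  assumes "\<nu> \<ge> 1" and "s \<in> {0..\<nu> - 1}"
  shows "nonneg_poly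
    (G (int L) (int L + 1 + 2 * int s)
       ((of_nat \<nu> + 1) * (1 + (1 + 2 * of_nat s) / (2 * of_nat \<nu> + 1)))
       ((of_nat \<nu> + 1) * (1 - (1 + 2 * of_nat s) / (2 * of_nat \<nu> + 1)))
       (2 * int \<nu> + 1))"
    (is "nonneg_poly ?G")
proof -
  define K where "K = 2 * int \<nu> + 1"
  \<comment> \<open>The bounds come from 0 <= L - Kj <= 2L + 2s + 1 together with |j| <= |Kj|; they
    also cover the Andrews-Gordon sums for all k <= L + s.\<close>
  define J where "J = {- int L - 2 * int s - 1..int L}"
  \<comment> \<open>\<open>E\<close> is the exponent in G after K cancels the denominator 2\<nu> +
    1; \<open>e\<close> is the Andrews-Gordon exponent.\<close>
  define E where "E j = (int \<nu> + 1) * (j * (K * j + 2 * int s + 1))" for j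
  define e :: "int \<Rightarrow> rat" where "e j = of_int (j * (K * j + 2 * int s + 1)) / 2" for j
  have s: "int s < int \<nu>" using assms by auto
  have J: "j \<in> J" if "- int L - 2 * int s - 1 \<le> K * j" "K * j \<le> int L" for j
  proof -
    have "1 \<le> K" by (simp add: K_def)
    then have "0 \<le> j \<and> 1 * j \<le> K * j \<or> j < 0 \<and> K * j \<le> 1 * j"
      using mult_right_mono[of 1 K j] mult_right_mono_neg[of 1 K j] by linarith
    then show ?thesis using that unfolding J_def atLeastAtMost_iff by linarith
  qed
  have summand: "G_term (int L) (int L + 1 + 2 * int s)
       ((of_nat \<nu> + 1) * (1 + (1 + 2 * of_nat s) / (2 * of_nat \<nu> + 1)))
       ((of_nat \<nu> + 1) * (1 - (1 + 2 * of_nat s) / (2 * of_nat \<nu> + 1))) K j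
     = (-1) ^ nat \<bar>j\<bar> * (qpow (of_int (E j)) * gauss (2 * int (L + s) + 1) (int L - K * j))" for j
  proof -
    define a b c d x :: rat
      where "a = of_nat \<nu>" and "b = of_nat s" and "c = of_int j" and "d = 2 * a + 1"
        and "x = (1 + 2 * b) / d"
    have "d > 0" unfolding d_def a_def by (simp add: add_nonneg_pos)
    then have dx: "d * x = 1 + 2 * b" by (simp add: x_def)
    have "d * c * ((((a + 1) * (1 + x) + (a + 1) * (1 - x)) * c
        + ((a + 1) * (1 + x) - (a + 1) * (1 - x))) / 2) = (a + 1) * (c * (d * c + d * x))"
      by (simp add: field_simps)
    also have "\<dots> = of_int (E j)"
      unfolding dx by (simp add: E_def K_def a_def b_def c_def d_def)
    finally have "of_int K * of_int j * ((((a + 1) * (1 + x) + (a + 1) * (1 - x)) * of_int j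
        + ((a + 1) * (1 + x) - (a + 1) * (1 - x))) / 2) = (of_int (E j) :: rat)"
      by (simp add: K_def a_def c_def d_def)
    moreover have "int L + (int L + 1 + 2 * int s) = 2 * int (L + s) + 1" by simp
    ultimately show ?thesis
      unfolding G_term_def gauss_def a_def b_def d_def x_def by (simp only: mult.assoc)
  qed
  have G: "?G = (\<Sum>j\<in>J. (-1) ^ nat \<bar>j\<bar> * (qpow (of_int (E j)) * gauss (2 * int (L + s) + 1) (int L - K * j)))"
    unfolding G_def K_def[symmetric] summand
  proof (rule Sum_any.expand_superset)
    show "finite J" by (simp add: J_def)
    show "{j. (-1) ^ nat \<bar>j\<bar> * (qpow (of_int (E j)) * gauss (2 * int (L + s) + 1) (int L - K * j)) \<noteq> 0} \<subseteq> J"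
    proof
      fix j assume "j \<in> {j. (-1) ^ nat \<bar>j\<bar> * (qpow (of_int (E j)) * gauss (2 * int (L + s) + 1) (int L - K * j)) \<noteq> 0}"
      then have "gauss (2 * int (L + s) + 1) (int L - K * j) \<noteq> 0" by auto
      then have "0 \<le> int L - K * j" "int L - K * j \<le> 2 * int (L + s) + 1"
        by (meson gauss_eq_0 not_le)+
      then show "j \<in> J" by (intro J) auto
    qed
  qed
  have "nat_exponents ?G"
  proof -
    have "E j \<ge> 0" for j
    proof (cases "j \<ge> 0")
      case True
      then show ?thesis by (simp add: E_def K_def)
    next
      case False
      \<comment> \<open>For j < 0 the second factor is at most -K + 2s + 1 = 2(s - \<nu>), so s <
        \<nu> makes the product of two nonpositive factors.\<close>
      then have "K * j \<le> - K" using mult_left_mono[of j "-1" K] by (simp add: K_def)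
      then have "K * j + 2 * int s + 1 \<le> 0" using s by (simp add: K_def)
      then show ?thesis using False by (simp add: E_def mult_nonpos_nonpos)
    qed
    then have "(of_int (E j) :: rat) \<in> \<nat>" for j
      by (metis of_int_of_nat_eq of_nat_in_Nats zero_le_imp_eq_int)
    moreover have "nat_exponents ((-1) ^ n)" for n
      by (induction n) (auto intro: nat_exponents_uminus)
    ultimately show ?thesis unfolding G
      by (auto intro!: nat_exponents_sum nat_exponents_mult nat_exponents_qpow)
  qed
  moreover have "nonneg_coeffs ?G"
  proof -
    have div_2_bounds: "0 \<le> x" "x \<le> 2 * k + 1" if "0 \<le> x div 2" "x div 2 \<le> k" for x k :: int
      using that by presburger+
    \<comment> \<open>T(Kj + s) - T(s) = Kj(Kj + 2s + 1)/2, and (K + 1)/2 = \<nu> + 1. This splits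
      off the power of q that \<open>gauss_transformation\<close> absorbs.\<close>
    have expo: "tri (int s) + of_int (E j) = e j + tri (K * j + int s)" for j
      by (simp add: tri_def E_def e_def K_def field_simps)
    have "qpow (tri (int s)) * ?G = (\<Sum>j\<in>J. (-1) ^ nat \<bar>j\<bar>
        * (qpow (e j) * (qpow (tri (K * j + int s)) * gauss (2 * int (L + s) + 1) (int (L + s) - (K * j + int s)))))"
      unfolding G sum_distrib_left
    proof (rule sum.cong[OF refl])
      fix j
      \<comment> \<open>Replacing L by L + s makes the upper index 2(L + s) + 1 odd and central,
        with offset n = Kj + s.\<close>
      have shift: "int (L + s) - (K * j + int s) = int L - K * j" by simp
      have "qpow (tri (int s)) * ((-1) ^ nat \<bar>j\<bar>
          * (qpow (of_int (E j)) * gauss (2 * int (L + s) + 1) (int L - K * j)))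
        = (-1) ^ nat \<bar>j\<bar>
          * ((qpow (tri (int s)) * qpow (of_int (E j))) * gauss (2 * int (L + s) + 1) (int L - K * j))"
        by (simp only: mult_ac)
      then show "qpow (tri (int s)) * ((-1) ^ nat \<bar>j\<bar>
          * (qpow (of_int (E j)) * gauss (2 * int (L + s) + 1) (int L - K * j)))
        = (-1) ^ nat \<bar>j\<bar> * (qpow (e j) * (qpow (tri (K * j + int s))
          * gauss (2 * int (L + s) + 1) (int (L + s) - (K * j + int s))))"
        by (simp only: qpow_add[symmetric] expo shift) (simp only: qpow_add mult.assoc)
    qed
    also have "\<dots> = (\<Sum>j\<in>J. \<Sum>k\<in>{0..int (L + s)}. trans_coeff (L + s) k
        * ((-1) ^ nat \<bar>j\<bar> * (qpow (e j) * gauss k ((k - (K * j + int s)) div 2))))"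
      unfolding gauss_transformation[symmetric] sum_distrib_left by (simp only: mult_ac)
    also have "\<dots> = (\<Sum>k\<in>{0..int (L + s)}. trans_coeff (L + s) k
        * (\<Sum>j\<in>J. (-1) ^ nat \<bar>j\<bar> * (qpow (e j) * gauss k ((k - (K * j + int s)) div 2))))"
      unfolding sum_distrib_left by (rule sum.swap)
    also have "nonneg_coeffs \<dots>"
    proof (rule nonneg_coeffs_sum, rule nonneg_coeffs_mult[OF nonneg_coeffs_trans_coeff])
      fix k assume k: "k \<in> {0..int (L + s)}"
      show "nonneg_coeffs (\<Sum>j\<in>J. (-1) ^ nat \<bar>j\<bar> * (qpow (e j) * gauss k ((k - (K * j + int s)) div 2)))"
        unfolding e_def K_def
      proof (rule nonneg_andrews_gordon_sum)
        show "finite J" by (simp add: J_def)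
        fix j assume "0 \<le> (k - ((2 * int \<nu> + 1) * j + int s)) div 2" "(k - ((2 * int \<nu> + 1) * j + int s)) div 2 \<le> k"
        then have "0 \<le> k - (K * j + int s)" "k - (K * j + int s) \<le> 2 * k + 1"
          unfolding K_def by (rule div_2_bounds)+
        then show "j \<in> J" using k by (intro J) auto
      qed (use s in auto)
    qed
    finally have "nonneg_coeffs (qpow (- tri (int s)) * (qpow (tri (int s)) * ?G))"
      by (rule nonneg_coeffs_mult[OF nonneg_coeffs_qpow])
    then show ?thesis by (simp add: mult.assoc[symmetric] qpow_add[symmetric])
  qed
  ultimately show ?thesis
    by (simp add: nonneg_poly_def nonneg_coeffs_def nat_exponents_def)
qed

end
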